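(* Let $p$ be a prime, let $n, k, r$ and $v_1 \leq \ldots \leq v_r$ be positive integers, and let $G = \bigoplus_{i=1}^r \mathbb{Z}/p^{v_i}\mathbb{Z}$. Let $x_1,\ldots,x_n$ be a sequence of elements of $G$. Let $A_1,\ldots,A_n$ be nonempty subsets of $\mathbb{Z}$, each containing $0$, such that for each $i$ the elements of $A_i$ are pairwise incongruent modulo $p$. Put $A = \prod_{i=1}^n A_i$ and $a_M = \max_{1 \leq i \leq n} \# A_i$. For $x \in G$, let $\operatorname{EGZ}_{A,k}(x)$ be the number of $(a_1,\ldots,a_n) \in A$ such that $a_1 x_1 + \ldots + a_n x_n = x$ and $p^k \mid \# \{ 1 \leq i \leq n \mid a_i \neq 0\}$. Then either $\operatorname{EGZ}_{A,k}(x) = 0$ or \[ \operatorname{EGZ}_{A,k}(x) \geq \mathfrak{m}\Big(\# A_1,\ldots,\# A_n;\ \# A_1 + \ldots + \# A_n - \sum_{i=1}^r (p^{v_i}-1) - (a_M-1)(p^k-1)\Big). \]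
   Context: Definition of $\mathfrak{m}$. Let $a_1,\ldots,a_n \geq 1$ be integers. For an integer $N$ with $n \leq N \leq a_1+\ldots+a_n$, a distribution of $N$ balls is an $n$-tuple of integers $y = (y_1,\ldots,y_n)$ with $1 \leq y_i \leq a_i$ for all $i$ and $y_1+\ldots+y_n = N$; put $P(y) = y_1 \cdots y_n$. Then $\mathfrak{m}(a_1,\ldots,a_n;N)$ is the minimum of $P(y)$ over all such distributions. For integers $N < n$ put $\mathfrak{m}(a_1,\ldots,a_n;N) = 1$, and for integers $N > a_1+\ldots+a_n$ put $\mathfrak{m}(a_1,\ldots,a_n;N) = a_1\cdots a_n$. (The value does not depend on the order of $a_1,\ldots,a_n$.) *)

theory Defs
  imports "HOL-Algebra.FiniteProduct" "HOL-Algebra.Product_Groups" "HOL-Number_Theory.Cong"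
begin

text \<open>Finite families are indexed by \<open>{1..n}\<close>. Extensional functions (\<open>\<Pi>\<^sub>E\<close>) represent
  \<open>n\<close>-tuples, so that cardinalities of sets of tuples are not affected by the values of a
  function outside the index range.\<close>

definition distributions :: "nat \<Rightarrow> (nat \<Rightarrow> nat) \<Rightarrow> int \<Rightarrow> (nat \<Rightarrow> nat) set" where
  "distributions n a N = {y \<in> (\<Pi>\<^sub>E i\<in>{1..n}. {1..a i}). int (\<Sum>i=1..n. y i) = N}"

text \<open>Intended for \<open>a i \<ge> 1\<close>; then the set whose minimum is taken is finite and nonempty. The
  argument \<open>N\<close> is an integer because it may be negative.\<close>

definition min_prod :: "nat \<Rightarrow> (nat \<Rightarrow> nat) \<Rightarrow> int \<Rightarrow> nat" where
  "min_prod n a N =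
     (if N < int n then 1
      else if N > int (\<Sum>i=1..n. a i) then (\<Prod>i=1..n. a i)
      else Min ((\<lambda>y. \<Prod>i=1..n. y i) ` distributions n a N))"

definition p_group :: "nat \<Rightarrow> nat \<Rightarrow> (nat \<Rightarrow> nat) \<Rightarrow> (nat \<Rightarrow> int) monoid" where
  "p_group p r v = sum_group {1..r} (\<lambda>i. integer_mod_group (p ^ v i))"

text \<open>The group \<open>G\<close> is written multiplicatively, as in HOL-Algebra: the integer multiple
  \<open>a\<^sub>i x\<^sub>i\<close> is the power \<open>xs i [^] a i\<close>, and the sum \<open>a\<^sub>1 x\<^sub>1 + \<dots> + a\<^sub>n x\<^sub>n\<close> is a \<open>finprod\<close>.\<close>

definition EGZ ::
  "nat \<Rightarrow> nat \<Rightarrow> nat \<Rightarrow> ('g, 'm) monoid_scheme \<Rightarrow> (nat \<Rightarrow> 'g) \<Rightarrow> (nat \<Rightarrow> int set) \<Rightarrow> 'g \<Rightarrow> nat" where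
  "EGZ p k n G xs A x =
     card {a \<in> (\<Pi>\<^sub>E i\<in>{1..n}. A i).
             (\<Otimes>\<^bsub>G\<^esub>i\<in>{1..n}. xs i [^]\<^bsub>G\<^esub> a i) = x \<and>
             p ^ k dvd card {i \<in> {1..n}. a i \<noteq> 0}}"

end

theory Submission
  imports Defs "HOL-Computational_Algebra.Polynomial"
begin

text \<open>
  The proof is a polynomial method over the field with \<open>p\<close> elements. The tuples to be counted are
  the points of the grid \<open>\<Prod>A\<^sub>i\<close> at which a certain function \<open>F\<close> does not vanish modulo \<open>p\<close>, where
  \<open>F\<close> agrees on the grid with a polynomial of degree at most
  \<open>d = \<Sum>(p\<^bsup>v\<^sub>j\<^esup> - 1) + (a\<^sub>M - 1)(p\<^sup>k - 1)\<close>.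
  The Alon--Fueredi bound then finishes the argument: a function of degree at most \<open>d\<close> that does
  not vanish identically on the grid is nonzero at \<open>\<Prod>y\<^sub>i\<close> points at least, for some \<open>y\<close> with
  \<open>1 \<le> y\<^sub>i \<le> #A\<^sub>i\<close> and \<open>\<Sum>y\<^sub>i \<ge> \<Sum>#A\<^sub>i - d\<close> (\<open>grid_nonzeros_bound\<close>); lowering some of the
  \<open>y\<^sub>i\<close> gives a distribution of exactly \<open>\<Sum>#A\<^sub>i - d\<close> balls, unless that number is less than \<open>n\<close> and
  the bound is \<open>1\<close> (\<open>min_prod_le\<close>).

  The function \<open>F\<close> is a product of binomial coefficients. By \<open>not_dvd_binomial_iff\<close>,
  \<open>M choose (p\<^sup>v - 1)\<close> is prime to \<open>p\<close> exactly if \<open>p\<^sup>v\<close> divides \<open>M + 1\<close>. So a condition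
  \<open>\<Sum>a\<^sub>i x\<^sub>i\<^sub>j \<equiv> x\<^sub>j (mod p\<^bsup>v\<^sub>j\<^esup>)\<close> is detected by \<open>M choose (p\<^bsup>v\<^sub>j\<^esup> - 1)\<close>, where \<open>M\<close> is a sum of
  a constant and of natural numbers congruent to the \<open>a\<^sub>i x\<^sub>i\<^sub>j\<close>, and the condition on the support is
  detected by \<open>(E + (p\<^sup>k - 1)) choose (p\<^sup>k - 1)\<close>, where \<open>E\<close> is the number of nonzero \<open>a\<^sub>i\<close>.

  For the degrees, Vandermonde's identity reduces \<open>M choose s\<close> to products of the binomial
  coefficients of the summands (\<open>binomial_degree_add\<close>), each of which depends on one coordinate only.
  If \<open>s < p\<close>, the coefficient \<open>t choose s\<close> is modulo \<open>p\<close> a polynomial of degree \<open>s\<close>; if \<open>s \<ge> p\<close>,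
  then every function of \<open>a\<^sub>i\<close> on \<open>A\<^sub>i\<close> has degree at most \<open>#A\<^sub>i - 1 < p \<le> s\<close> by Lagrange
  interpolation. In the same way the indicator of \<open>a\<^sub>i \<noteq> 0\<close> has degree at most \<open>a\<^sub>M - 1\<close>.
\<close>

section \<open>Functions of bounded degree modulo a prime on a grid\<close>

text \<open>\<open>poly_deg p I A d f\<close> says that on the grid \<open>\<Prod>i\<in>I. A i\<close> the function \<open>f\<close> agrees modulo \<open>p\<close>
  with an integer polynomial in the coordinates \<open>a i\<close>, \<open>i \<in> I\<close>, of total degree at most \<open>d\<close>. The
  grid is the set \<open>Pi I A\<close>, on which nothing is assumed about the coordinates outside of \<open>I\<close>; such
  functions therefore depend modulo \<open>p\<close> only on the coordinates in \<open>I\<close>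
  (lemma \<open>poly_deg_depends\<close>).\<close>

inductive poly_deg ::
  "nat \<Rightarrow> 'i set \<Rightarrow> ('i \<Rightarrow> int set) \<Rightarrow> nat \<Rightarrow> (('i \<Rightarrow> int) \<Rightarrow> int) \<Rightarrow> bool"
  for p :: nat and I :: "'i set" and A :: "'i \<Rightarrow> int set" where
  const: "poly_deg p I A d (\<lambda>a. c)"
| add: "poly_deg p I A d f \<Longrightarrow> poly_deg p I A d g \<Longrightarrow> poly_deg p I A d (\<lambda>a. f a + g a)"
| coord: "i \<in> I \<Longrightarrow> poly_deg p I A d f \<Longrightarrow> poly_deg p I A (Suc d) (\<lambda>a. a i * f a)"
| cong: "poly_deg p I A d f \<Longrightarrow> (\<And>a. a \<in> Pi I A \<Longrightarrow> [g a = f a] (mod int p)) \<Longrightarrow> poly_deg p I A d g"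

lemma poly_deg_mono:
  assumes "poly_deg p I A d f" "d \<le> e"
  shows "poly_deg p I A e f"
  using assms
proof (induction arbitrary: e rule: poly_deg.induct)
  case (coord i d f)
  then obtain e' where "e = Suc e'" "d \<le> e'"
    by (cases e) auto
  then show ?case
    using coord by (auto intro: poly_deg.coord)
next
  case (cong d f g)
  show ?case
    by (rule poly_deg.cong[OF cong.IH[OF cong.prems] cong.hyps(2)])
qed (auto intro: poly_deg.const poly_deg.add)

lemma poly_deg_scale: "poly_deg p I A d f \<Longrightarrow> poly_deg p I A d (\<lambda>a. c * f a)"
proof (induction rule: poly_deg.induct)
  case (add d f g)
  then show ?case
    using poly_deg.add[of p I A d "\<lambda>a. c * f a" "\<lambda>a. c * g a"] by (simp add: distrib_left)
next
  case (coord i d f)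
  then show ?case
    using poly_deg.coord[of i I p A d "\<lambda>a. c * f a"] by (simp add: mult.left_commute)
next
  case (cong d f g)
  show ?case
    by (rule poly_deg.cong[OF cong.IH cong_scalar_left[OF cong.hyps(2)]])
qed (rule poly_deg.const)

lemma poly_deg_mult:
  assumes "poly_deg p I A d f" "poly_deg p I A e g"
  shows "poly_deg p I A (d + e) (\<lambda>a. f a * g a)"
  using assms(1)
proof (induction rule: poly_deg.induct)
  case (const d c)
  show ?case
    using poly_deg_scale[OF assms(2)] by (rule poly_deg_mono) simp
next
  case (add d f f')
  then show ?case
    using poly_deg.add[of p I A "d + e" "\<lambda>a. f a * g a" "\<lambda>a. f' a * g a"]
    by (simp add: distrib_right)
next
  case (coord i d f)
  then show ?case
    using poly_deg.coord[of i I p A "d + e" "\<lambda>a. f a * g a"] by (simp add: mult.assoc)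
next
  case (cong d f f')
  show ?case
    by (rule poly_deg.cong[OF cong.IH cong_scalar_right[OF cong.hyps(2)]])
qed

lemma poly_deg_sum:
  "(\<And>j. j \<in> S \<Longrightarrow> poly_deg p I A d (f j)) \<Longrightarrow> poly_deg p I A d (\<lambda>a. \<Sum>j\<in>S. f j a)"
  by (induction S rule: infinite_finite_induct) (auto intro: poly_deg.const poly_deg.add)

lemma poly_deg_prod:
  "(\<And>j. j \<in> S \<Longrightarrow> poly_deg p I A (d j) (f j)) \<Longrightarrow>
    poly_deg p I A (\<Sum>j\<in>S. d j) (\<lambda>a. \<Prod>j\<in>S. f j a)"
  by (induction S rule: infinite_finite_induct) (auto intro: poly_deg.const poly_deg_mult)

lemma poly_deg_linear:
  assumes "i \<in> I"
  shows "poly_deg p I A 1 (\<lambda>a. c * a i + b)"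
proof -
  have "poly_deg p I A 1 (\<lambda>a. a i * c)"
    using poly_deg.coord[OF assms poly_deg.const[where d = 0 and c = c]] by simp
  then show ?thesis
    using poly_deg.add[OF _ poly_deg.const[where c = b]] by (simp add: mult.commute)
qed

lemma poly_deg_depends:
  assumes "poly_deg p I A d f" "a \<in> Pi I A" "\<And>i. i \<in> I \<Longrightarrow> a i = b i"
  shows "[f a = f b] (mod int p)"
  using assms(1)
proof (induction rule: poly_deg.induct)
  case (coord i d f)
  then show ?case
    using assms(3) by (auto intro: cong_mult)
next
  case (cong d f g)
  have "b \<in> Pi I A"
    using assms by (auto simp: Pi_iff)
  with cong assms(2) show ?case
    by (meson cong_trans cong_sym)
qed (auto intro: cong_add)

section \<open>The Alon--Fueredi bound\<close>

lemma finite_incongruent: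
  assumes "p > 0" "inj_on (\<lambda>t. t mod int p) S"
  shows "finite S" "card S \<le> p"
proof -
  have sub: "(\<lambda>t. t mod int p) ` S \<subseteq> {0..<int p}"
    using assms(1) by auto
  show "finite S"
    using finite_imageD[OF finite_subset[OF sub] assms(2)] by simp
  show "card S \<le> p"
    using card_mono[OF _ sub] by (simp add: card_image[OF assms(2)])
qed

lemma card_roots_mod_prime_le:
  fixes f :: "int poly"
  assumes "prime p" "degree f \<le> u" "\<not> int p dvd coeff f u"
    and "inj_on (\<lambda>t. t mod int p) S" "\<And>t. t \<in> S \<Longrightarrow> int p dvd poly f t"
  shows "card S \<le> u"
  using assms(2-5)
proof (induction u arbitrary: f S)
  case 0
  then obtain c where "f = [:c:]"
    by (metis degree_eq_zeroE le_zero_eq)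
  with 0 have "S = {}"
    by auto
  then show ?case
    by simp
next
  case (Suc u)
  show ?case
  proof (cases "S = {}")
    case False
    then obtain r where r: "r \<in> S"
      by blast
    define q where "q = synthetic_div f r"
    have f_eq: "f + smult r q = pCons (poly f r) q"
      unfolding q_def by (rule synthetic_div_correct)
    have deg_q: "degree q \<le> u"
      using Suc.prems(1) by (simp add: q_def degree_synthetic_div)
    then have "coeff q u = coeff f (Suc u)"
      using arg_cong[OF f_eq, of "\<lambda>g. coeff g (Suc u)"] by (simp add: coeff_eq_0)
    moreover have "int p dvd poly q t" if t: "t \<in> S - {r}" for t
    proof -
      have "poly f t + r * poly q t = poly f r + t * poly q t"
        using arg_cong[OF f_eq, of "\<lambda>g. poly g t"] by simp
      then have "(t - r) * poly q t = poly f t - poly f r"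
        by (simp add: algebra_simps)
      then have "int p dvd (t - r) * poly q t"
        using Suc.prems(4) r t by (metis DiffD1 dvd_diff)
      moreover have "\<not> int p dvd t - r"
        using Suc.prems(3) r t by (auto simp: inj_on_def mod_eq_dvd_iff)
      ultimately show ?thesis
        using assms(1) by (simp add: prime_dvd_mult_iff)
    qed
    moreover have "inj_on (\<lambda>t. t mod int p) (S - {r})"
      using Suc.prems(3) by (rule inj_on_subset) auto
    ultimately have "card (S - {r}) \<le> u"
      using Suc.IH[of q "S - {r}"] Suc.prems(2) deg_q by simp
    then show ?thesis
      using r by (simp add: card_Diff_singleton)
  qed simp
qed

text \<open>Expansion in one variable along the Newton basis \<open>\<Prod>l<j. (t - b\<^sub>l)\<close>. When \<open>b\<close> enumerates
  \<open>A i\<close>, the basis elements with \<open>j \<ge> #A\<^sub>i\<close> vanish on \<open>A i\<close>, so that no reduction of powers of the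
  variable is needed.\<close>

lemma poly_deg_insert_expand:
  fixes b :: "nat \<Rightarrow> int"
  assumes "poly_deg p (insert i I) A d f"
  shows "\<exists>g. (\<forall>j. poly_deg p I A (d - j) (g j)) \<and>
    (\<forall>a\<in>Pi (insert i I) A. [f a = (\<Sum>j\<le>d. g j a * (\<Prod>l<j. a i - b l))] (mod int p))"
  using assms
proof (induction rule: poly_deg.induct)
  case (const d c)
  have "poly_deg p I A (d - j) (\<lambda>a. if j = 0 then c else 0)" for j
    by (rule poly_deg.const)
  moreover have "(\<Sum>j\<le>d. (if j = 0 then c else 0) * (\<Prod>l<j. a i - b l)) = c" for a
    using sum.delta[of "{..d}" 0 "\<lambda>_. c"]
    by (subst sum.cong[OF refl, of _ _ "\<lambda>j. if j = 0 then c else 0"]) auto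
  ultimately show ?case
    by (intro exI[of _ "\<lambda>j a. if j = 0 then c else 0"]) auto
next
  case (add d f f')
  then obtain g g' where
    g: "\<And>j. poly_deg p I A (d - j) (g j)" "\<And>j. poly_deg p I A (d - j) (g' j)"
    "\<And>a. a\<in>Pi (insert i I) A \<Longrightarrow> [f a = (\<Sum>j\<le>d. g j a * (\<Prod>l<j. a i - b l))] (mod int p)"
    "\<And>a. a\<in>Pi (insert i I) A \<Longrightarrow> [f' a = (\<Sum>j\<le>d. g' j a * (\<Prod>l<j. a i - b l))] (mod int p)"
    by blast
  show ?case
    by (rule exI[of _ "\<lambda>j a. g j a + g' j a"])
      (auto simp: distrib_right sum.distrib intro: poly_deg.add g cong_add)
next
  case (coord i' d f)
  then obtain g where
    g: "\<And>j. poly_deg p I A (d - j) (g j)"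
    "\<And>a. a\<in>Pi (insert i I) A \<Longrightarrow> [f a = (\<Sum>j\<le>d. g j a * (\<Prod>l<j. a i - b l))] (mod int p)"
    by blast
  define N where "N j a = (\<Prod>l<j. a i - b l)" for j and a :: "'a \<Rightarrow> int"
  have f: "[a i' * f a = (\<Sum>j\<le>d. a i' * g j a * N j a)] (mod int p)"
    if "a \<in> Pi (insert i I) A" for a
    using cong_scalar_left[OF g(2)[OF that], of "a i'"]
    by (simp add: sum_distrib_left mult.assoc N_def)
  show ?case
  proof (cases "i' = i")
    case False
    define h where "h j a = (if j \<le> d then a i' * g j a else 0)" for j and a :: "'a \<Rightarrow> int"
    have "poly_deg p I A (Suc d - j) (h j)" for j
    proof (cases "j \<le> d")
      case True
      then have "h j = (\<lambda>a. a i' * g j a)" "Suc d - j = Suc (d - j)"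
        by (auto simp: h_def)
      then show ?thesis
        using False coord.hyps g(1) by (auto intro: poly_deg.coord)
    next
      case nle: False
      then have "h j = (\<lambda>a. 0)"
        by (auto simp: h_def)
      then show ?thesis
        by (simp add: poly_deg.const)
    qed
    moreover have "(\<Sum>j\<le>Suc d. h j a * N j a) = (\<Sum>j\<le>d. a i' * g j a * N j a)" for a
      by (auto simp: h_def intro: sum.cong)
    ultimately show ?thesis
      using f by (intro exI[of _ h]) (simp add: N_def)
  next
    case True
    \<comment> \<open>Multiply the basis by the variable: \<open>t N\<^sub>j(t) = N\<^sub>j\<^sub>+\<^sub>1(t) + b\<^sub>j N\<^sub>j(t)\<close>.\<close>
    define h where
      "h j a = (if j = 0 then 0 else g (j - 1) a) + (if j \<le> d then b j * g j a else 0)"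
      for j and a :: "'a \<Rightarrow> int"
    have "poly_deg p I A (Suc d - j) (h j)" for j
    proof -
      have "poly_deg p I A (Suc d - j) (\<lambda>a. if j = 0 then 0 else g (j - 1) a)"
        using g(1)[of "j - 1"] by (cases j) (auto intro: poly_deg.const)
      moreover have "poly_deg p I A (Suc d - j) (\<lambda>a. if j \<le> d then b j * g j a else 0)"
        using poly_deg_mono[OF poly_deg_scale[OF g(1)[of j], of "b j"], of "Suc d - j"]
        by (cases "j \<le> d") (auto intro: poly_deg.const)
      ultimately show ?thesis
        unfolding h_def by (rule poly_deg.add)
    qed
    moreover have "(\<Sum>j\<le>Suc d. h j a * N j a) = (\<Sum>j\<le>d. a i' * g j a * N j a)" for a
    proof -
      have "(\<Sum>j\<le>Suc d. h j a * N j a) =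
          (\<Sum>j\<le>Suc d. (if j = 0 then 0 else g (j - 1) a) * N j a) +
          (\<Sum>j\<le>Suc d. (if j \<le> d then b j * g j a else 0) * N j a)"
        by (simp add: h_def distrib_right sum.distrib)
      also have "(\<Sum>j\<le>Suc d. (if j = 0 then 0 else g (j - 1) a) * N j a) =
          (\<Sum>j\<le>d. g j a * N (Suc j) a)"
        by (subst sum.atMost_Suc_shift) simp
      also have "(\<Sum>j\<le>Suc d. (if j \<le> d then b j * g j a else 0) * N j a) =
          (\<Sum>j\<le>d. b j * g j a * N j a)"
        by (auto intro: sum.cong)
      also have "(\<Sum>j\<le>d. g j a * N (Suc j) a) + (\<Sum>j\<le>d. b j * g j a * N j a) =
          (\<Sum>j\<le>d. a i' * g j a * N j a)"
        unfolding sum.distrib[symmetric]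
        by (rule sum.cong) (auto simp: N_def True algebra_simps)
      finally show ?thesis .
    qed
    ultimately show ?thesis
      using f by (intro exI[of _ h]) (simp add: N_def)
  qed
next
  case (cong d f f')
  then show ?case
    by (meson cong_trans)
qed

lemma card_newton_nonzeros_ge:
  fixes b :: "nat \<Rightarrow> int"
  assumes "prime p" "inj_on (\<lambda>t. t mod int p) S" "\<not> int p dvd c u"
  shows "card S - u \<le> card {t \<in> S. \<not> int p dvd (\<Sum>j\<le>u. c j * (\<Prod>l<j. t - b l))}"
proof -
  define N where "N j = (\<Prod>l<j. [:- b l, 1:])" for j
  have deg: "degree (N j) = j" and lead: "coeff (N j) j = 1" for j
  proof -
    show "degree (N j) = j"
      unfolding N_def by (subst degree_prod_eq_sum_degree) auto
    then show "coeff (N j) j = 1"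
      using lead_coeff_prod[of "\<lambda>l. [:- b l, 1:]" "{..<j}"] by (simp add: N_def)
  qed
  define f where "f = (\<Sum>j\<le>u. smult (c j) (N j))"
  have poly_f: "poly f t = (\<Sum>j\<le>u. c j * (\<Prod>l<j. t - b l))" for t
    by (simp add: f_def N_def poly_sum poly_prod)
  have "degree f \<le> u"
    unfolding f_def by (rule degree_sum_le) (auto simp: deg intro: order.trans[OF degree_smult_le])
  moreover have "coeff f u = c u"
  proof -
    have "coeff f u = (\<Sum>j\<le>u. if j = u then c u else 0)"
      unfolding f_def coeff_sum by (rule sum.cong) (auto simp: lead deg coeff_eq_0)
    then show ?thesis
      by simp
  qed
  moreover have "inj_on (\<lambda>t. t mod int p) {t \<in> S. int p dvd poly f t}"
    using assms(2) by (rule inj_on_subset) auto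
  ultimately have "card {t \<in> S. int p dvd poly f t} \<le> u"
    using assms(3) by (intro card_roots_mod_prime_le[OF assms(1)]) auto
  moreover have "finite S"
    using finite_incongruent(1)[OF _ assms(2)] prime_gt_0_nat[OF assms(1)] by blast
  moreover from this have
    "card S = card {t \<in> S. int p dvd poly f t} + card {t \<in> S. \<not> int p dvd poly f t}"
    by (subst card_Un_disjoint[symmetric]) (auto intro: arg_cong[where f = card])
  ultimately show ?thesis
    by (simp add: poly_f)
qed

text \<open>The witness \<open>y i\<close> is \<open>#A\<^sub>i - u\<^sub>i\<close>, where the \<open>u\<^sub>i\<close> form a lexicographically leading
  exponent of \<open>f\<close>. For the variable added in the induction step, \<open>u\<close> is the largest index less than
  \<open>#A\<^sub>i\<close> whose coefficient in the Newton expansion of \<open>f\<close> does not vanish identically on the grid of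
  the other variables. At each point where that coefficient is nonzero, the slice of \<open>f\<close> is a polynomial in
  one variable with at most \<open>u\<close> roots.\<close>

theorem grid_nonzeros_bound:
  assumes "prime p" "finite I" "\<And>i. i \<in> I \<Longrightarrow> inj_on (\<lambda>t. t mod int p) (A i)"
    and "poly_deg p I A d f" "\<exists>a\<in>Pi\<^sub>E I A. \<not> int p dvd f a"
  shows "\<exists>y. (\<forall>i\<in>I. 1 \<le> y i \<and> y i \<le> card (A i)) \<and> (\<Sum>i\<in>I. card (A i)) \<le> (\<Sum>i\<in>I. y i) + d \<and>
    (\<Prod>i\<in>I. y i) \<le> card {a \<in> Pi\<^sub>E I A. \<not> int p dvd f a}"
  using assms(2-5)
proof (induction I arbitrary: d f rule: finite_induct)
  case empty
  then have "{a \<in> Pi\<^sub>E {} A. \<not> int p dvd f a} = {\<lambda>_. undefined}"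
    by auto
  then show ?case
    by simp
next
  case (insert i I)
  define m where "m = card (A i)"
  have fin: "finite (A j)" if "j \<in> insert i I" for j
    using finite_incongruent(1)[OF prime_gt_0_nat[OF assms(1)] insert.prems(1)[OF that]] .
  obtain b where b: "bij_betw b {..<m} (A i)"
    using ex_bij_betw_nat_finite[of "A i"] fin by (auto simp: m_def lessThan_atLeast0)
  obtain g where g: "\<And>j. poly_deg p I A (d - j) (g j)"
    "\<And>a. a\<in>Pi (insert i I) A \<Longrightarrow> [f a = (\<Sum>j\<le>d. g j a * (\<Prod>l<j. a i - b l))] (mod int p)"
    using poly_deg_insert_expand[OF insert.prems(2), of b] by blast
  define J where "J = {j. j \<le> d \<and> j < m \<and> (\<exists>a\<in>Pi\<^sub>E I A. \<not> int p dvd g j a)}"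
  have slice: "[f (a(i := t)) = (\<Sum>j\<le>d. g j a * (\<Prod>l<j. t - b l))] (mod int p)"
    if "a \<in> Pi\<^sub>E I A" "t \<in> A i" for a t
  proof -
    have "a(i := t) \<in> Pi (insert i I) A"
      using that by (auto simp: Pi_iff PiE_iff)
    moreover have "[g j (a(i := t)) = g j a] (mod int p)" for j
      by (rule cong_sym, rule poly_deg_depends[OF g(1)]) (use that insert.hyps(2) in auto)
    ultimately show ?thesis
      using g(2)[of "a(i := t)"] by (force intro: cong_trans cong_sum cong_scalar_right)
  qed
  have vanish: "(\<Prod>l<j. t - b l) = 0" if "t \<in> A i" "m \<le> j" for j t
  proof -
    have "t \<in> b ` {..<m}"
      using b that(1) by (simp add: bij_betw_def)
    then obtain l where "l < m" "t = b l"
      by blast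
    then show ?thesis
      using that(2) by (intro prod_zero) auto
  qed
  have small: "int p dvd g j a * (\<Prod>l<j. t - b l)"
    if "a \<in> Pi\<^sub>E I A" "t \<in> A i" "j \<le> d" "j \<notin> J" for j a t
  proof (cases "j < m")
    case True
    then show ?thesis
      using that by (auto simp: J_def)
  next
    case False
    then have "(\<Prod>l<j. t - b l) = 0"
      using that(2) by (intro vanish) auto
    then show ?thesis
      by (simp only: mult_zero_right dvd_0_right)
  qed
  obtain a0 where a0: "a0 \<in> Pi\<^sub>E (insert i I) A" "\<not> int p dvd f a0"
    using insert.prems(3) by blast
  \<comment> \<open>Otherwise every term of the expansion, and hence \<open>f\<close>, vanishes on the grid.\<close>
  have "J \<noteq> {}"
  proof
    assume "J = {}"
    obtain a t where at: "a \<in> Pi\<^sub>E I A" "t \<in> A i" "a0 = a(i := t)"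
      using a0(1) by (auto simp: PiE_insert_eq)
    have "int p dvd (\<Sum>j\<le>d. g j a * (\<Prod>l<j. t - b l))"
      by (rule dvd_sum) (use small[OF at(1,2)] \<open>J = {}\<close> in auto)
    then show False
      using slice[OF at(1,2)] a0(2) at(3) by (auto simp: cong_dvd_iff)
  qed
  moreover have "finite J"
    by (rule finite_subset[of _ "{..d}"]) (auto simp: J_def)
  ultimately have u_in: "Max J \<in> J" and u_max: "\<And>j. j \<in> J \<Longrightarrow> j \<le> Max J"
    by auto
  define u where "u = Max J"
  have u: "u \<le> d" "u < m" "\<exists>a\<in>Pi\<^sub>E I A. \<not> int p dvd g u a"
    using u_in by (auto simp: J_def u_def)
  obtain y where y: "\<And>j. j \<in> I \<Longrightarrow> 1 \<le> y j \<and> y j \<le> card (A j)"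
    "(\<Sum>j\<in>I. card (A j)) \<le> (\<Sum>j\<in>I. y j) + (d - u)"
    "(\<Prod>j\<in>I. y j) \<le> card {a \<in> Pi\<^sub>E I A. \<not> int p dvd g u a}"
    using insert.IH[OF _ g(1) u(3)] insert.prems(1) by blast
  define U where "U = {a \<in> Pi\<^sub>E I A. \<not> int p dvd g u a}"
  define T where "T a = {t \<in> A i. \<not> int p dvd f (a(i := t))}" for a
  have T_ge: "m - u \<le> card (T a)" if "a \<in> U" for a
  proof -
    have a: "a \<in> Pi\<^sub>E I A" "\<not> int p dvd g u a"
      using that by (auto simp: U_def)
    have "int p dvd f (a(i := t)) \<longleftrightarrow> int p dvd (\<Sum>j\<le>u. g j a * (\<Prod>l<j. t - b l))"
      if "t \<in> A i" for t
    proof -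
      have "(\<Sum>j\<le>d. g j a * (\<Prod>l<j. t - b l)) = (\<Sum>j\<le>u. g j a * (\<Prod>l<j. t - b l)) +
          (\<Sum>j\<in>{u<..d}. g j a * (\<Prod>l<j. t - b l))"
        by (subst sum.union_disjoint[symmetric]) (use u(1) in \<open>auto intro: sum.cong\<close>)
      moreover have "int p dvd (\<Sum>j\<in>{u<..d}. g j a * (\<Prod>l<j. t - b l))"
        by (rule dvd_sum, rule small[OF a(1) that]) (use u_max in \<open>force simp: u_def\<close>)+
      ultimately show ?thesis
        using cong_dvd_iff[OF slice[OF a(1) that]] by (simp add: dvd_add_left_iff)
    qed
    then have "T a = {t \<in> A i. \<not> int p dvd (\<Sum>j\<le>u. g j a * (\<Prod>l<j. t - b l))}"
      by (auto simp: T_def)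
    then show ?thesis
      using card_newton_nonzeros_ge[OF assms(1), of "A i" "\<lambda>j. g j a" u b] insert.prems(1) a(2)
      by (simp add: m_def)
  qed
  have fin_U: "finite U"
    using finite_PiE[of I A] insert.hyps(1) fin by (simp add: U_def)
  have "(m - u) * (\<Prod>j\<in>I. y j) \<le> (\<Sum>a\<in>U. m - u)"
    using y(3) by (simp add: U_def[symmetric])
  also have "\<dots> \<le> (\<Sum>a\<in>U. card (T a))"
    by (rule sum_mono) (rule T_ge)
  also have "\<dots> = card (SIGMA a:U. T a)"
    using fin_U fin by (simp add: T_def)
  also have "\<dots> \<le> card {a \<in> Pi\<^sub>E (insert i I) A. \<not> int p dvd f a}"
  proof (rule card_inj_on_le[where f = "\<lambda>(a, t). a(i := t)"])
    have "inj_on (\<lambda>(t, a). a(i := t)) (A i \<times> Pi\<^sub>E I A)"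
      using insert.hyps(2) by (rule inj_combinator)
    then show "inj_on (\<lambda>(a, t). a(i := t)) (SIGMA a:U. T a)"
      by (auto simp: inj_on_def U_def T_def)
    show "(\<lambda>(a, t). a(i := t)) ` (SIGMA a:U. T a) \<subseteq> {a \<in> Pi\<^sub>E (insert i I) A. \<not> int p dvd f a}"
      by (auto simp: U_def T_def PiE_insert_eq)
    show "finite {a \<in> Pi\<^sub>E (insert i I) A. \<not> int p dvd f a}"
      using finite_PiE[of "insert i I" A] insert.hyps(1) fin by simp
  qed
  finally have le: "(m - u) * (\<Prod>j\<in>I. y j) \<le> card {a \<in> Pi\<^sub>E (insert i I) A. \<not> int p dvd f a}" .
  define z where "z = y(i := m - u)"
  have z: "z i = m - u" "\<And>j. j \<in> I \<Longrightarrow> z j = y j"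
    using insert.hyps(2) by (auto simp: z_def)
  have "(\<Sum>j\<in>I. z j) = (\<Sum>j\<in>I. y j)" "(\<Prod>j\<in>I. z j) = (\<Prod>j\<in>I. y j)"
    using z(2) by auto
  then show ?case
    using insert.hyps le y(1,2) z u(1,2)
    by (intro exI[of _ z]) (auto simp: m_def[symmetric])
qed

text \<open>Lowering coordinates one by one reaches every smaller number of balls that still leaves at
  least one ball for each index, and the product can only decrease.\<close>

lemma exists_distribution_below:
  fixes y :: "'i \<Rightarrow> nat"
  assumes "finite I" "\<And>i. i \<in> I \<Longrightarrow> 1 \<le> y i" "card I \<le> N" "N \<le> (\<Sum>i\<in>I. y i)"
  shows "\<exists>z. (\<forall>i\<in>I. 1 \<le> z i \<and> z i \<le> y i) \<and> (\<Sum>i\<in>I. z i) = N \<and> (\<Prod>i\<in>I. z i) \<le> (\<Prod>i\<in>I. y i)"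
  using assms(2,4)
proof (induction "(\<Sum>i\<in>I. y i) - N" arbitrary: y)
  case 0
  then show ?case
    by (intro exI[of _ y]) auto
next
  case (Suc x)
  have "\<exists>i\<in>I. 1 < y i"
  proof (rule ccontr)
    assume "\<not> ?thesis"
    then have "(\<Sum>i\<in>I. y i) \<le> (\<Sum>i\<in>I. 1)"
      by (intro sum_mono) auto
    then show False
      using assms(3) Suc.hyps(2) by simp
  qed
  then obtain i where i: "i \<in> I" "1 < y i"
    by blast
  define w where "w = y(i := y i - 1)"
  have w: "\<And>j. j \<in> I \<Longrightarrow> 1 \<le> w j" "\<And>j. w j \<le> y j"
    using i Suc.prems(1) by (auto simp: w_def)
  have "(\<Sum>j\<in>I. y j) = y i + (\<Sum>j\<in>I - {i}. y j)" "(\<Sum>j\<in>I. w j) = w i + (\<Sum>j\<in>I - {i}. w j)"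
    using assms(1) i(1) by (auto intro: sum.remove)
  moreover have "(\<Sum>j\<in>I - {i}. w j) = (\<Sum>j\<in>I - {i}. y j)"
    by (rule sum.cong) (auto simp: w_def)
  ultimately have "(\<Sum>j\<in>I. y j) = Suc (\<Sum>j\<in>I. w j)"
    using i(2) by (simp add: w_def)
  then have "x = (\<Sum>j\<in>I. w j) - N" "N \<le> (\<Sum>j\<in>I. w j)"
    using Suc.hyps(2) by auto
  then obtain z where z: "\<forall>j\<in>I. 1 \<le> z j \<and> z j \<le> w j" "(\<Sum>j\<in>I. z j) = N"
      "(\<Prod>j\<in>I. z j) \<le> (\<Prod>j\<in>I. w j)"
    using Suc.hyps(1) w(1) by blast
  have "(\<Prod>j\<in>I. w j) \<le> (\<Prod>j\<in>I. y j)"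
    by (rule prod_mono) (use w(2) in auto)
  then show ?case
    using z w(2) by (intro exI[of _ z]) (auto intro: order.trans)
qed

lemma min_prod_le:
  assumes y: "\<And>i. i \<in> {1..n} \<Longrightarrow> 1 \<le> y i \<and> y i \<le> a i"
    and le: "(\<Sum>i=1..n. a i) \<le> (\<Sum>i=1..n. y i) + d"
  shows "min_prod n a (int (\<Sum>i=1..n. a i) - int d) \<le> (\<Prod>i=1..n. y i)"
proof (cases "int (\<Sum>i=1..n. a i) - int d < int n")
  case True
  have "(\<Prod>i=1..n. 1) \<le> (\<Prod>i=1..n. y i)"
    by (rule prod_mono) (use y in auto)
  then show ?thesis
    using True by (simp add: min_prod_def)
next
  case False
  define N where "N = (\<Sum>i=1..n. a i) - d"
  have N: "int N = int (\<Sum>i=1..n. a i) - int d" "n \<le> N" "N \<le> (\<Sum>i=1..n. y i)"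
    using False le unfolding N_def by linarith+
  obtain z where z: "\<forall>i\<in>{1..n}. 1 \<le> z i \<and> z i \<le> y i" "(\<Sum>i=1..n. z i) = N"
      "(\<Prod>i=1..n. z i) \<le> (\<Prod>i=1..n. y i)"
    using exists_distribution_below[of "{1..n}" y N] N y by auto
  have "restrict z {1..n} \<in> distributions n a (int N)"
    using z y by (fastforce simp: distributions_def)
  moreover have "finite (distributions n a (int N))"
    unfolding distributions_def by (auto intro!: finite_PiE)
  ultimately have "Min ((\<lambda>y. \<Prod>i=1..n. y i) ` distributions n a (int N)) \<le>
      (\<Prod>i=1..n. restrict z {1..n} i)"
    by (intro Min_le finite_imageI imageI)
  then show ?thesis
    using False z(3) by (simp add: min_prod_def N(1))
qed

section \<open>Binomial coefficients modulo a prime\<close>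

lemma prime_dvd_choose_prime_power:
  assumes "prime p" "0 < s" "s < p ^ v"
  shows "p dvd (p ^ v choose s)"
proof (rule ccontr)
  assume "\<not> ?thesis"
  then have "coprime (p ^ v) (p ^ v choose s)"
    using assms(1) by (simp add: prime_imp_coprime)
  moreover have "p ^ v dvd s * (p ^ v choose s)"
    using times_binomial_minus1_eq[OF assms(2), of "p ^ v"] by simp
  ultimately have "p ^ v dvd s"
    by (simp add: coprime_dvd_mult_left_iff)
  then show False
    using assms(2,3) by (auto dest: dvd_imp_le)
qed

lemma choose_add_prime_power_cong:
  assumes "prime p" "s < p ^ v"
  shows "[(p ^ v + m) choose s = m choose s] (mod p)"
proof -
  have "[(\<Sum>j\<le>s. (p ^ v choose j) * (m choose (s - j))) =
      (\<Sum>j\<le>s. if j = 0 then m choose s else 0)] (mod p)"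
    by (rule cong_sum)
      (use assms prime_dvd_choose_prime_power[OF assms(1)] in \<open>auto simp: cong_0_iff\<close>)
  then show ?thesis
    by (simp add: vandermonde)
qed

text \<open>By the previous lemma, \<open>m choose (p\<^sup>v - 1)\<close> depends modulo \<open>p\<close> only on \<open>m\<close> modulo \<open>p\<^sup>v\<close>;
  for \<open>m < p\<^sup>v\<close> it is \<open>1\<close> if \<open>m = p\<^sup>v - 1\<close> and \<open>0\<close> otherwise.\<close>

lemma not_dvd_binomial_iff:
  assumes "prime p"
  shows "\<not> p dvd (m choose (p ^ v - 1)) \<longleftrightarrow> p ^ v dvd Suc m"
proof -
  have q: "p ^ v > 0"
    using assms by (simp add: prime_gt_0_nat)
  show ?thesis
  proof (induction m rule: less_induct)
    case (less m)
    show ?case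
    proof (cases "m < p ^ v")
      case True
      consider "m = p ^ v - 1" | "m < p ^ v - 1"
        using True by linarith
      then show ?thesis
      proof cases
        case 1
        then show ?thesis
          using q assms by (auto dest: prime_gt_1_nat)
      next
        case 2
        then have "\<not> p ^ v dvd Suc m"
          by (auto dest: dvd_imp_le)
        then show ?thesis
          using 2 by (simp add: binomial_eq_0)
      qed
    next
      case False
      then obtain l where l: "m = p ^ v + l"
        using le_Suc_ex not_less by blast
      have "p dvd (m choose (p ^ v - 1)) \<longleftrightarrow> p dvd (l choose (p ^ v - 1))"
        unfolding l by (rule cong_dvd_iff[OF choose_add_prime_power_cong[OF assms]]) (use q in auto)
      moreover have "p ^ v dvd Suc m \<longleftrightarrow> p ^ v dvd Suc l"
        using dvd_add_right_iff[of "p ^ v" "p ^ v" "Suc l"] by (simp add: l)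
      ultimately show ?thesis
        using less.IH[of l] q l by simp
    qed
  qed
qed

text \<open>The function \<open>h\<close> behaves like a polynomial of degree at most \<open>w\<close> also when it is substituted into
  binomial coefficients, although these need not be polynomials in \<open>h\<close> modulo \<open>p\<close>.\<close>

definition binomial_degree ::
  "nat \<Rightarrow> 'i set \<Rightarrow> ('i \<Rightarrow> int set) \<Rightarrow> nat \<Rightarrow> (('i \<Rightarrow> int) \<Rightarrow> nat) \<Rightarrow> bool" where
  "binomial_degree p I A w h \<longleftrightarrow> (\<forall>s. poly_deg p I A (w * s) (\<lambda>a. int (h a choose s)))"

lemma binomial_degree_const: "binomial_degree p I A w (\<lambda>a. c)"
  by (simp add: binomial_degree_def poly_deg.const)

lemma binomial_degree_add:
  assumes "binomial_degree p I A w h" "binomial_degree p I A w h'"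
  shows "binomial_degree p I A w (\<lambda>a. h a + h' a)"
  unfolding binomial_degree_def
proof
  fix s
  have "poly_deg p I A (w * s) (\<lambda>a. int (h a choose j) * int (h' a choose (s - j)))" if "j \<le> s" for j
  proof -
    have "w * s = w * j + w * (s - j)"
      using that by (simp add: distrib_left[symmetric])
    then show ?thesis
      using assms by (simp add: binomial_degree_def poly_deg_mult)
  qed
  then have "poly_deg p I A (w * s) (\<lambda>a. \<Sum>j\<le>s. int (h a choose j) * int (h' a choose (s - j)))"
    by (intro poly_deg_sum) simp
  then show "poly_deg p I A (w * s) (\<lambda>a. int ((h a + h' a) choose s))"
    by (simp flip: vandermonde)
qed

lemma binomial_degree_sum:
  "(\<And>j. j \<in> S \<Longrightarrow> binomial_degree p I A w (h j)) \<Longrightarrow> binomial_degree p I A w (\<lambda>a. \<Sum>j\<in>S. h j a)"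
  by (induction S rule: infinite_finite_induct)
    (auto intro: binomial_degree_const binomial_degree_add)

lemma cong_inverse_prime:
  assumes "prime p" "\<not> int p dvd x"
  obtains c where "[c * x = 1] (mod int p)"
proof -
  have "coprime (int p) x"
    using assms by (intro prime_imp_coprime) auto
  then have "coprime x (int p)"
    by (rule coprime_commute[THEN iffD1])
  then show ?thesis
    using cong_solve_coprime_int[of x "int p"] that by (metis mult.commute)
qed

text \<open>Lagrange interpolation.\<close>

lemma poly_deg_one_coordinate:
  assumes "prime p" "i \<in> I" "inj_on (\<lambda>t. t mod int p) (A i)"
  shows "poly_deg p I A (card (A i) - 1) (\<lambda>a. h (a i))"
proof -
  have fin: "finite (A i)"
    using finite_incongruent(1)[OF _ assms(3)] prime_gt_0_nat[OF assms(1)] by blast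
  have "\<exists>c. [c * (\<Prod>b'\<in>A i - {b}. b - b') = 1] (mod int p)" if "b \<in> A i" for b
  proof -
    have "\<not> int p dvd b - b'" if "b' \<in> A i - {b}" for b'
      using assms(3) that \<open>b \<in> A i\<close> by (auto simp: inj_on_def mod_eq_dvd_iff)
    then have "\<not> int p dvd (\<Prod>b'\<in>A i - {b}. b - b')"
      using assms(1) fin by (simp add: prime_dvd_prod_iff)
    then show ?thesis
      using cong_inverse_prime[OF assms(1)] by metis
  qed
  then obtain c where c: "\<And>b. b \<in> A i \<Longrightarrow> [c b * (\<Prod>b'\<in>A i - {b}. b - b') = 1] (mod int p)"
    by metis
  define L where "L t = (\<Sum>b\<in>A i. h b * c b * (\<Prod>b'\<in>A i - {b}. t - b'))" for t
  have "poly_deg p I A (card (A i) - 1) (\<lambda>a. h b * c b * (\<Prod>b'\<in>A i - {b}. a i - b'))"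
    if "b \<in> A i" for b
  proof (rule poly_deg_scale)
    have "poly_deg p I A 1 (\<lambda>a. a i - b')" for b'
      using poly_deg_linear[OF assms(2), of p A 1 "- b'"] by simp
    then have "poly_deg p I A (\<Sum>b'\<in>A i - {b}. 1) (\<lambda>a. \<Prod>b'\<in>A i - {b}. a i - b')"
      by (rule poly_deg_prod)
    then show "poly_deg p I A (card (A i) - 1) (\<lambda>a. \<Prod>b'\<in>A i - {b}. a i - b')"
      using that by simp
  qed
  then have "poly_deg p I A (card (A i) - 1) (\<lambda>a. L (a i))"
    unfolding L_def by (rule poly_deg_sum)
  then show ?thesis
  proof (rule poly_deg.cong)
    fix a assume "a \<in> Pi I A"
    then have t: "a i \<in> A i"
      using assms(2) by auto
    have "L (a i) = h (a i) * (c (a i) * (\<Prod>b'\<in>A i - {a i}. a i - b'))"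
    proof -
      have "(\<Prod>b'\<in>A i - {b}. a i - b') = 0" if "b \<in> A i - {a i}" for b
        using that fin t by (intro prod_zero) auto
      then have "(\<Sum>b\<in>A i - {a i}. h b * c b * (\<Prod>b'\<in>A i - {b}. a i - b')) = 0"
        by (intro sum.neutral) auto
      then show ?thesis
        unfolding L_def by (subst sum.remove[OF fin t]) (simp add: mult.assoc)
    qed
    then show "[h (a i) = L (a i)] (mod int p)"
      using cong_scalar_left[OF c[OF t], of "h (a i)"] by (simp add: cong_sym)
  qed
qed

text \<open>For \<open>s < p\<close> the factorial of \<open>s\<close> is invertible modulo \<open>p\<close>, and \<open>h choose s\<close> is a product
  of \<open>s\<close> linear factors divided by it. For \<open>s \<ge> p\<close> interpolation suffices, because \<open>#A\<^sub>i \<le> p\<close>.\<close>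

lemma binomial_degree_linear:
  assumes "prime p" "i \<in> I" "inj_on (\<lambda>t. t mod int p) (A i)"
    and h: "\<And>t. [int (h t) = c * t] (mod int p)"
  shows "binomial_degree p I A 1 (\<lambda>a. h (a i))"
  unfolding binomial_degree_def
proof
  fix s
  show "poly_deg p I A (1 * s) (\<lambda>a. int (h (a i) choose s))"
  proof (cases "s < p")
    case True
    then have "\<not> p dvd fact s"
      using assms(1) by (simp add: prime_dvd_fact_iff)
    then have "\<not> int p dvd fact s"
      by (metis of_nat_dvd_iff of_nat_fact)
    then obtain e where e: "[e * fact s = 1] (mod int p)"
      using cong_inverse_prime[OF assms(1)] by blast
    define P where "P a = (\<Prod>l=0..<s. c * a i - int l)" for a
    have "poly_deg p I A (\<Sum>l=0..<s. 1) P"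
      unfolding P_def
      by (rule poly_deg_prod) (use poly_deg_linear[OF assms(2)] in \<open>simp flip: add_uminus_conv_diff\<close>)
    then have "poly_deg p I A s (\<lambda>a. e * P a)"
      by (intro poly_deg_scale) simp
    moreover have "[int (h t choose s) = e * (\<Prod>l=0..<s. c * t - int l)] (mod int p)" for t
    proof -
      have "[int (h t choose s) = e * fact s * int (h t choose s)] (mod int p)"
        using cong_scalar_right[OF e, of "int (h t choose s)"] by (simp add: cong_sym)
      also have "e * fact s * int (h t choose s) = e * (\<Prod>l=0..<s. int (h t) - int l)"
        by (simp add: int_binomial gbinomial_int_mult_fact mult.assoc)
      also have "[\<dots> = e * (\<Prod>l=0..<s. c * t - int l)] (mod int p)"
        by (intro cong_scalar_left cong_prod cong_diff h cong_refl)
      finally show ?thesis .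
    qed
    ultimately show ?thesis
      unfolding P_def by (auto intro: poly_deg.cong)
  next
    case False
    have "card (A i) \<le> p"
      using finite_incongruent(2)[OF _ assms(3)] prime_gt_0_nat[OF assms(1)] by blast
    then show ?thesis
      using False poly_deg_one_coordinate[where A = A, OF assms(1-3), of "\<lambda>t. int (h t choose s)"]
      by (elim poly_deg_mono) auto
  qed
qed

text \<open>An indicator choose \<open>s\<close> is a function of one coordinate, which has degree at most \<open>#A\<^sub>i - 1\<close>;
  the case \<open>s = 0\<close>, in which degree \<open>0\<close> is claimed, is the constant \<open>1\<close>.\<close>

lemma binomial_degree_indicator:
  assumes "prime p" "i \<in> I" "inj_on (\<lambda>t. t mod int p) (A i)" "card (A i) - 1 \<le> w"
  shows "binomial_degree p I A w (\<lambda>a. of_bool (Q (a i)))"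
  unfolding binomial_degree_def
proof
  fix s
  show "poly_deg p I A (w * s) (\<lambda>a. int (of_bool (Q (a i)) choose s))"
  proof (cases "s = 0")
    case True
    then show ?thesis
      by (simp add: poly_deg.const)
  next
    case False
    then have "w * 1 \<le> w * s"
      by (intro mult_le_mono2) simp
    then have "card (A i) - 1 \<le> w * s"
      using assms(4) by linarith
    then show ?thesis
      using poly_deg_one_coordinate[where A = A, OF assms(1-3), of "\<lambda>t. int (of_bool (Q t) choose s)"]
      by (elim poly_deg_mono)
  qed
qed

section \<open>Coordinates in the group\<close>

lemma carrier_p_group:
  assumes "p > 0"
  shows "carrier (p_group p r v) = (\<Pi>\<^sub>E j\<in>{1..r}. {0..<int p ^ v j})"
proof -
  have "carrier (p_group p r v) = (\<Pi>\<^sub>E j\<in>{1..r}. carrier (integer_mod_group (p ^ v j)))"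
    by (auto simp: p_group_def carrier_sum_group)
  then show ?thesis
    using assms by (simp add: carrier_integer_mod_group)
qed

lemma comm_group_p_group: "comm_group (p_group p r v)"
proof (rule group.group_comm_groupI)
  show "group (p_group p r v)"
    by (simp add: p_group_def)
qed (auto simp: p_group_def add.commute)

lemma p_group_int_pow_component:
  assumes "z \<in> carrier (p_group p r v)" "j \<in> {1..r}"
  shows "(z [^]\<^bsub>p_group p r v\<^esub> (m :: int)) j = (m * z j) mod int (p ^ v j)"
proof -
  interpret G: comm_group "p_group p r v"
    by (rule comm_group_p_group)
  have "(\<lambda>w. w j) \<in> hom (p_group p r v) (integer_mod_group (p ^ v j))"
    using assms(2) by (auto simp: hom_def p_group_def carrier_sum_group)
  then have "(z [^]\<^bsub>p_group p r v\<^esub> m) j = z j [^]\<^bsub>integer_mod_group (p ^ v j)\<^esub> m"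
    using hom_int_pow[OF _ assms(1) G.is_group group_integer_mod_group] by blast
  then show ?thesis
    by (simp add: int_pow_integer_mod_group)
qed

lemma p_group_finprod_component:
  assumes "finite S" "\<And>i. i \<in> S \<Longrightarrow> xs i \<in> carrier (p_group p r v)" "j \<in> {1..r}"
  shows "(\<Otimes>\<^bsub>p_group p r v\<^esub>i\<in>S. xs i [^]\<^bsub>p_group p r v\<^esub> (a i :: int)) j =
    (\<Sum>i\<in>S. a i * xs i j) mod int (p ^ v j)"
proof -
  interpret G: comm_group "p_group p r v"
    by (rule comm_group_p_group)
  show ?thesis
    using assms(1,2)
  proof (induction S rule: finite_induct)
    case empty
    have "\<one>\<^bsub>p_group p r v\<^esub> j = 0"
      using assms(3) by (simp add: p_group_def)
    then show ?case
      by simp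
  next
    case (insert i S)
    have mult: "(y \<otimes>\<^bsub>p_group p r v\<^esub> z) j = (y j + z j) mod int (p ^ v j)" for y z
      using assms(3) by (simp add: p_group_def)
    show ?case
      using insert assms(3)
      by (subst G.finprod_insert) (auto simp: mult p_group_int_pow_component mod_add_eq)
  qed
qed

lemma p_group_finprod_eq_iff:
  fixes xs :: "nat \<Rightarrow> nat \<Rightarrow> int" and a :: "nat \<Rightarrow> int"
  assumes "p > 0" "\<And>i. i \<in> {1..n} \<Longrightarrow> xs i \<in> carrier (p_group p r v)" "x \<in> carrier (p_group p r v)"
  shows "(\<Otimes>\<^bsub>p_group p r v\<^esub>i\<in>{1..n}. xs i [^]\<^bsub>p_group p r v\<^esub> a i) = x \<longleftrightarrow>
    (\<forall>j\<in>{1..r}. int (p ^ v j) dvd (\<Sum>i=1..n. a i * xs i j) - x j)"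
proof -
  interpret G: comm_group "p_group p r v"
    by (rule comm_group_p_group)
  define y where "y = (\<Otimes>\<^bsub>p_group p r v\<^esub>i\<in>{1..n}. xs i [^]\<^bsub>p_group p r v\<^esub> a i)"
  have y: "y \<in> carrier (p_group p r v)"
    unfolding y_def using assms(2) by (intro G.finprod_closed) auto
  have "y = x \<longleftrightarrow> (\<forall>j\<in>{1..r}. y j = x j)"
    using y assms(3) unfolding carrier_p_group[OF assms(1)] by (auto intro: PiE_ext)
  also have "\<dots> \<longleftrightarrow> (\<forall>j\<in>{1..r}. int (p ^ v j) dvd (\<Sum>i=1..n. a i * xs i j) - x j)"
  proof (rule ball_cong[OF refl])
    fix j assume j: "j \<in> {1..r}"
    have "x j = x j mod int (p ^ v j)"
      using assms(3) j by (auto simp: carrier_p_group[OF assms(1)] PiE_iff)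
    then have "y j = x j \<longleftrightarrow> (\<Sum>i=1..n. a i * xs i j) mod int (p ^ v j) = x j mod int (p ^ v j)"
      using p_group_finprod_component[where S = "{1..n}" and a = a, OF _ assms(2) j] by (simp add: y_def)
    then show "y j = x j \<longleftrightarrow> int (p ^ v j) dvd (\<Sum>i=1..n. a i * xs i j) - x j"
      by (simp add: mod_eq_dvd_iff)
  qed
  finally show ?thesis
    by (simp add: y_def)
qed

section \<open>The lower bound\<close>

theorem theorem4p11:
  fixes p n k r :: nat and v :: "nat \<Rightarrow> nat"
    and xs :: "nat \<Rightarrow> (nat \<Rightarrow> int)" and x :: "nat \<Rightarrow> int"
    and A :: "nat \<Rightarrow> int set"
  assumes "prime p"
    and "n > 0" and "k > 0" and "r > 0"
    and "\<And>i. i \<in> {1..r} \<Longrightarrow> v i > 0"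
    and "mono_on {1..r} v"
    and "\<And>i. i \<in> {1..n} \<Longrightarrow> xs i \<in> carrier (p_group p r v)"
    and "\<And>i. i \<in> {1..n} \<Longrightarrow> 0 \<in> A i"
    and "\<And>i a b. i \<in> {1..n} \<Longrightarrow> a \<in> A i \<Longrightarrow> b \<in> A i \<Longrightarrow> a \<noteq> b \<Longrightarrow> \<not> [a = b] (mod int p)"
    and "x \<in> carrier (p_group p r v)"
  shows "EGZ p k n (p_group p r v) xs A x = 0 \<or>
    EGZ p k n (p_group p r v) xs A x \<ge>
      min_prod n (\<lambda>i. card (A i))
        ((\<Sum>i=1..n. int (card (A i)))
         - (\<Sum>i=1..r. (int p ^ v i - 1))
         - (int (Max ((\<lambda>i. card (A i)) ` {1..n})) - 1) * (int p ^ k - 1))"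
proof -
  note p = \<open>prime p\<close>
  have p0: "p > 0"
    using p by (rule prime_gt_0_nat)
  define I where "I = {1..n}"
  define G where "G = p_group p r v"
  define M where "M = Max ((\<lambda>i. card (A i)) ` I)"
  have inj: "inj_on (\<lambda>t. t mod int p) (A i)" if "i \<in> I" for i
    using assms(9) that by (auto simp: inj_on_def cong_def I_def)
  have card_pos: "1 \<le> card (A i)" if "i \<in> I" for i
    using finite_incongruent(1)[OF p0 inj[OF that]] assms(8) that
    by (auto simp: I_def Suc_le_eq card_gt_0_iff)
  have M_ge: "card (A i) \<le> M" if "i \<in> I" for i
    unfolding M_def using that by (intro Max_ge) (auto simp: I_def)
  have M_pos: "1 \<le> M"
    using card_pos[of 1] M_ge[of 1] \<open>n > 0\<close> by (simp add: I_def)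

  \<comment> \<open>Natural numbers are needed in the binomial coefficients, so the terms \<open>a i * xs i j\<close> are
    replaced by residues. The constant \<open>c j\<close> makes \<open>H j a + 1\<close> congruent to
    \<open>(\<Sum>i\<in>I. a i * xs i j) - x j\<close> modulo \<open>p ^ v j\<close>; likewise \<open>E a + 1\<close> is congruent to the number
    of nonzero \<open>a i\<close> modulo \<open>p ^ k\<close>.\<close>
  define h where "h j i t = nat (t * xs i j mod int (p ^ v j))" for j i t
  define c where "c j = nat ((- 1 - x j) mod int (p ^ v j))" for j
  define H where "H j a = (\<Sum>i\<in>I. h j i (a i)) + c j" for j and a :: "nat \<Rightarrow> int"
  define E where "E a = (\<Sum>i\<in>I. of_bool (a i \<noteq> 0)) + (p ^ k - 1)" for a :: "nat \<Rightarrow> int"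
  define F where
    "F a = (\<Prod>j=1..r. int (H j a choose (p ^ v j - 1))) * int (E a choose (p ^ k - 1))" for a
  define d where "d = (\<Sum>j=1..r. p ^ v j - 1) + (M - 1) * (p ^ k - 1)"

  have int_h: "int (h j i t) = t * xs i j mod int (p ^ v j)" for j i t
    using p0 by (simp add: h_def)
  have deg_H: "binomial_degree p I A 1 (H j)" if j: "j \<in> {1..r}" for j
  proof -
    have "binomial_degree p I A 1 (\<lambda>a. h j i (a i))" if "i \<in> I" for i
    proof (rule binomial_degree_linear[where A = A, OF p that inj[OF that]])
      fix t
      have "int p dvd int (p ^ v j)"
        using assms(5)[OF j] by (simp add: dvd_power)
      then have "t * xs i j mod int (p ^ v j) mod int p = t * xs i j mod int p"
        by (rule mod_mod_cancel)
      then show "[int (h j i t) = xs i j * t] (mod int p)"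
        by (simp add: int_h cong_def mult.commute)
    qed
    then show ?thesis
      unfolding H_def by (intro binomial_degree_add binomial_degree_sum binomial_degree_const)
  qed
  have "binomial_degree p I A (M - 1) E"
    unfolding E_def using p inj M_ge
    by (intro binomial_degree_add binomial_degree_sum binomial_degree_const
        binomial_degree_indicator diff_le_mono)
  then have "poly_deg p I A d F"
    unfolding F_def d_def using deg_H
    by (intro poly_deg_mult poly_deg_prod) (auto simp: binomial_degree_def dest!: spec)

  have H_iff: "\<not> p dvd (H j a choose (p ^ v j - 1)) \<longleftrightarrow>
      int (p ^ v j) dvd (\<Sum>i\<in>I. a i * xs i j) - x j" for j a
  proof -
    have "int (Suc (H j a)) =
        (\<Sum>i\<in>I. a i * xs i j mod int (p ^ v j)) + (- 1 - x j) mod int (p ^ v j) + 1"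
      using p0 by (simp add: H_def int_h c_def)
    also have "[\<dots> = (\<Sum>i\<in>I. a i * xs i j) + (- 1 - x j) + 1] (mod int (p ^ v j))"
      by (intro cong_add cong_sum cong_refl) simp_all
    finally have "[int (Suc (H j a)) = (\<Sum>i\<in>I. a i * xs i j) - x j] (mod int (p ^ v j))"
      by simp
    then show ?thesis
      unfolding not_dvd_binomial_iff[OF p] by (metis cong_dvd_iff of_nat_dvd_iff)
  qed
  have E_iff: "\<not> p dvd (E a choose (p ^ k - 1)) \<longleftrightarrow> p ^ k dvd card {i \<in> I. a i \<noteq> 0}" for a
  proof -
    have "(\<Sum>i\<in>I. of_bool (a i \<noteq> 0)) = card {i \<in> I. a i \<noteq> 0}"
      by (simp add: I_def of_bool_def sum.If_cases Int_def)
    then have "Suc (E a) = card {i \<in> I. a i \<noteq> 0} + p ^ k"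
      using p0 by (simp add: E_def)
    then show ?thesis
      unfolding not_dvd_binomial_iff[OF p] by simp
  qed
  have F_iff: "\<not> int p dvd F a \<longleftrightarrow>
      (\<Otimes>\<^bsub>G\<^esub>i\<in>{1..n}. xs i [^]\<^bsub>G\<^esub> a i) = x \<and> p ^ k dvd card {i \<in> {1..n}. a i \<noteq> 0}" for a
  proof -
    have "\<not> int p dvd F a \<longleftrightarrow> (\<forall>j\<in>{1..r}. \<not> p dvd (H j a choose (p ^ v j - 1))) \<and>
        \<not> p dvd (E a choose (p ^ k - 1))"
      using p by (simp add: F_def prime_dvd_mult_iff prime_dvd_prod_iff)
    also have "\<dots> \<longleftrightarrow> (\<forall>j\<in>{1..r}. int (p ^ v j) dvd (\<Sum>i\<in>I. a i * xs i j) - x j) \<and>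
        p ^ k dvd card {i \<in> I. a i \<noteq> 0}"
      by (simp only: H_iff E_iff)
    finally show ?thesis
      by (simp only: p_group_finprod_eq_iff[OF p0 assms(7,10)] G_def I_def)
  qed
  then have EGZ_eq: "EGZ p k n G xs A x = card {a \<in> Pi\<^sub>E I A. \<not> int p dvd F a}"
    by (simp add: EGZ_def I_def)

  have "int d = (\<Sum>j=1..r. int p ^ v j - 1) + (int M - 1) * (int p ^ k - 1)"
    using p0 M_pos by (simp add: d_def of_nat_diff Suc_le_eq)
  then have bound_eq: "(\<Sum>i=1..n. int (card (A i))) - (\<Sum>j=1..r. int p ^ v j - 1)
      - (int M - 1) * (int p ^ k - 1) = int (\<Sum>i=1..n. card (A i)) - int d"
    by simp
  show ?thesis
  proof (cases "\<exists>a\<in>Pi\<^sub>E I A. \<not> int p dvd F a")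
    case False
    then have "{a \<in> Pi\<^sub>E I A. \<not> int p dvd F a} = {}"
      by blast
    then have "EGZ p k n G xs A x = 0"
      using EGZ_eq by (simp only: card.empty)
    then show ?thesis
      by (simp add: G_def)
  next
    case True
    have "finite I"
      by (simp add: I_def)
    from grid_nonzeros_bound[OF p this inj \<open>poly_deg p I A d F\<close> True]
    obtain y where y: "\<forall>i\<in>I. 1 \<le> y i \<and> y i \<le> card (A i)"
      "(\<Sum>i\<in>I. card (A i)) \<le> (\<Sum>i\<in>I. y i) + d" "(\<Prod>i\<in>I. y i) \<le> EGZ p k n G xs A x"
      unfolding EGZ_eq by blast
    have "min_prod n (\<lambda>i. card (A i)) (int (\<Sum>i=1..n. card (A i)) - int d) \<le> (\<Prod>i=1..n. y i)"
      by (rule min_prod_le) (use y in \<open>auto simp: I_def\<close>)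
    also have "\<dots> \<le> EGZ p k n G xs A x"
      using y(3) by (simp add: I_def)
    finally show ?thesis
      unfolding bound_eq[symmetric] M_def I_def G_def by simp
  qed
qed

end
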